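(* Let $\mathcal{A}$ be a cluster algebra of rank $n$ (trivial coefficients) with a fixed cluster pattern $\mathbf{\Sigma}=\{\Sigma_t=(\mathbf{x}_t,B_t)\}_{t\in\mathbb{T}_n}$ with root vertex $t_0$, and assume its exchange matrices are indecomposable. For each vertex $t\in\mathbb{T}_n$ with $B_t\sim\pm B_{t_0}$, fix $\sigma_t\in S_n$ and $\varepsilon_t\in\{\pm\}$ with $\sigma_t B_{t_0}=\varepsilon_t B_t$, and let $f_{p(t_0,t)}:=(\Sigma_{t_0},\Sigma_t,\sigma_t,\varepsilon_t)\in\operatorname{Aut}(\mathcal{A})$. Let $G_0(t_0)$ be the set of cluster automorphisms of the form $(\Sigma_{t_0},\Sigma_{t_0},\sigma,\varepsilon)$ with $\sigma\in S_n$, $\varepsilon\in\{\pm\}$, $\sigma B_{t_0}=\varepsilon B_{t_0}$, and let $$H_1(t_0)=\{f_{p(t_0,t)}\mid t\in\mathbb{T}_n,\ B_t\sim\pm B_{t_0},\ \mathbf{w}_{t_0}(t_0,t)=2\}.$$ Then the cluster automorphism group $\operatorname{Aut}(\mathcal{A})$ is generated by $G_0(t_0)\cup H_1(t_0)$.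
   Context: Cluster algebras. Write $[x]_+=\max\{x,0\}$. An $n\times n$ integer matrix $B=(b_{ij})$ is skew-symmetrizable if $DB$ is skew-symmetric for some diagonal matrix $D$ with positive integer diagonal entries. It is indecomposable if the graph on $\{1,\dots,n\}$ with an edge between $i,j$ whenever $b_{ij}\ne0$ is connected. Let $\mathcal{F}$ be a field isomorphic to the field of rational functions over $\mathbb{Q}$ in $n$ variables. A labeled seed is a pair $\Sigma=(\mathbf{x},B)$ with $\mathbf{x}=(x_1,\dots,x_n)$ (the cluster) a free generating set of $\mathcal{F}$ and $B$ skew-symmetrizable (the exchange matrix). The mutation $\mu_k(\Sigma)=(\mathbf{x}',B')$ is given by $b'_{ij}=-b_{ij}$ if $i=k$ or $j=k$, $b'_{ij}=b_{ij}+b_{ik}[b_{kj}]_++[-b_{ik}]_+b_{kj}$ otherwise; $x'_i=x_i$ for $i\ne k$ and $x_k'=x_k^{-1}\big(\prod_j x_j^{[b_{jk}]_+}+\prod_j x_j^{[-b_{jk}]_+}\big)$. $\mathbb{T}_n$ is the $n$-regular tree with edges labeled by $1,\dots,n$, the $n$ edges at each vertex having distinct labels. A cluster pattern is a family $\mathbf{\Sigma}=\{\Sigma_t=(\mathbf{x}_t,B_t)\}_{t\in\mathbb{T}_n}$ of labeled seeds such that $\Sigma_{t'}=\mu_k(\Sigma_t)$ whenever $t,t'$ are joined by an edge labeled $k$; $t_0$ is a fixed root vertex. The cluster algebra $\mathcal{A}$ is the $\mathbb{Z}$-subalgebra of $\mathcal{F}$ generated by all cluster variables (entries of all $\mathbf{x}_t$).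 $S_n$-action. For $\sigma\in S_n$: $(\sigma\mathbf{x})_i=x_{\sigma^{-1}(i)}$ and $(\sigma B)_{ij}=b_{\sigma^{-1}(i)\sigma^{-1}(j)}$. Write $B\sim B'$ if $B'=\sigma B$ for some $\sigma\in S_n$, and $B\sim\pm B'$ if $B\sim B'$ or $B\sim -B'$. Cluster automorphisms. A $\mathbb{Z}$-algebra automorphism $f:\mathcal{A}\to\mathcal{A}$ is a cluster automorphism if there exist labeled seeds $(\mathbf{x},B),(\mathbf{x}',B')$ in $\mathbf{\Sigma}$ and $\sigma\in S_n$ such that $\sigma f(\mathbf{x})=\mathbf{x}'$ and $\sigma f(\mu_k(\mathbf{x}))=\mu_{\sigma(k)}(\mathbf{x}')$ for all $k$. $\operatorname{Aut}(\mathcal{A})$ is the group of cluster automorphisms under composition. If $\Sigma_1=(\mathbf{x}_1,B_1)$, $\Sigma_2=(\mathbf{x}_2,B_2)$ are seeds of $\mathbf{\Sigma}$ and $\sigma B_1=\varepsilon B_2$ with $\sigma\in S_n$, $\varepsilon\in\{\pm\}$, then $(\Sigma_1,\Sigma_2,\sigma,\varepsilon)$ denotes the unique cluster automorphism $f$ with $\sigma f(\mathbf{x}_1)=\mathbf{x}_2$. Every cluster automorphism can be written as $(\Sigma_{t_0},\Sigma_t,\sigma,\varepsilon)$ for some $t$. Weight. $p(t,t')$ is the unique path in $\mathbb{T}_n$ from $t$ to $t'$. For a vertex $s$, $\mathbf{w}_s(t,t')$ is the number of vertices $t''$ on $p(t,t')$ (endpoints included) with $B_{t''}\sim\pm B_s$.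 *)

theory Defs
  imports
    "HOL-Analysis.Finite_Cartesian_Product"
    "HOL-Library.Poly_Mapping"
    "HOL-Algebra.Bij"
    "HOL-Algebra.Generated_Groups"
begin

text \<open>
  The index set of size n is a finite type \<open>'n\<close>, so that S_n is the set of
  bijections \<open>'n \<Rightarrow> 'n\<close>. The ambient field is a type \<open>'a\<close> of class
  \<^class>\<open>field_char_0\<close>; that it is isomorphic to the field of rational functions over the
  rationals in n variables is expressed by the existence of a free generating set, which is part
  of the notion of a labeled seed.
\<close>

unbundle no m_inv_syntax

type_synonym ('a, 'n) seed = "('a, 'n) vec \<times> ((int, 'n) vec, 'n) vec"

abbreviation cluster :: "('a, 'n) seed \<Rightarrow> 'a ^ 'n::finite"
  where "cluster \<equiv> fst"

abbreviation exmat :: "('a, 'n) seed \<Rightarrow> int ^ 'n ^ 'n::finite"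
  where "exmat \<equiv> snd"


section \<open>Exchange matrices\<close>

definition skew_symmetrizable :: "int ^ 'n ^ 'n::finite \<Rightarrow> bool"
  where "skew_symmetrizable B \<longleftrightarrow>
    (\<exists>D :: int ^ 'n ^ 'n. (\<forall>i j. i \<noteq> j \<longrightarrow> D $ i $ j = 0) \<and> (\<forall>i. D $ i $ i > 0) \<and>
       transpose (D ** B) = - (D ** B))"

definition indecomposable :: "int ^ 'n ^ 'n::finite \<Rightarrow> bool"
  where "indecomposable B \<longleftrightarrow>
    (\<forall>i j. (\<lambda>k l. B $ k $ l \<noteq> 0 \<or> B $ l $ k \<noteq> 0)\<^sup>*\<^sup>* i j)"

definition perm_mat :: "('n \<Rightarrow> 'n) \<Rightarrow> int ^ 'n ^ 'n::finite \<Rightarrow> int ^ 'n ^ 'n"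
  where "perm_mat \<sigma> B = (\<chi> i j. B $ inv \<sigma> i $ inv \<sigma> j)"

definition perm_vec :: "('n \<Rightarrow> 'n) \<Rightarrow> 'a ^ 'n::finite \<Rightarrow> 'a ^ 'n"
  where "perm_vec \<sigma> x = (\<chi> i. x $ inv \<sigma> i)"

definition scale_mat :: "int \<Rightarrow> int ^ 'n ^ 'n::finite \<Rightarrow> int ^ 'n ^ 'n"
  where "scale_mat \<epsilon> B = (\<chi> i j. \<epsilon> * B $ i $ j)"

definition mat_sim :: "int ^ 'n ^ 'n::finite \<Rightarrow> int ^ 'n ^ 'n \<Rightarrow> bool"
  where "mat_sim B B' \<longleftrightarrow> (\<exists>\<sigma>. bij \<sigma> \<and> B' = perm_mat \<sigma> B)"

definition mat_sim_pm :: "int ^ 'n ^ 'n::finite \<Rightarrow> int ^ 'n ^ 'n \<Rightarrow> bool"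
  where "mat_sim_pm B B' \<longleftrightarrow> mat_sim B B' \<or> mat_sim B (- B')"


section \<open>Labeled seeds and mutation\<close>

definition poly_eval :: "'a::field_char_0 ^ 'n::finite \<Rightarrow> (('n \<Rightarrow>\<^sub>0 nat) \<Rightarrow>\<^sub>0 rat) \<Rightarrow> 'a"
  where "poly_eval x p =
    (\<Sum>m\<in>Poly_Mapping.keys p.
       of_rat (Poly_Mapping.lookup p m) * (\<Prod>i\<in>UNIV. x $ i ^ Poly_Mapping.lookup m i))"

definition subfield_set :: "'a::field set \<Rightarrow> bool"
  where "subfield_set K \<longleftrightarrow> 0 \<in> K \<and> 1 \<in> K \<and>
    (\<forall>a\<in>K. \<forall>b\<in>K. a + b \<in> K \<and> a * b \<in> K) \<and> (\<forall>a\<in>K. - a \<in> K \<and> inverse a \<in> K)"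

definition free_generating_set :: "'a::field_char_0 ^ 'n::finite \<Rightarrow> bool"
  where "free_generating_set x \<longleftrightarrow>
    (\<forall>p. poly_eval x p = 0 \<longrightarrow> p = 0) \<and> subfield_set hull (range (($) x)) = UNIV"

definition labeled_seed :: "('a::field_char_0, 'n::finite) seed \<Rightarrow> bool"
  where "labeled_seed S \<longleftrightarrow> free_generating_set (cluster S) \<and> skew_symmetrizable (exmat S)"

definition pos_part :: "int \<Rightarrow> int"
  where "pos_part b = max b 0"

definition mutate_mat :: "'n \<Rightarrow> int ^ 'n ^ 'n::finite \<Rightarrow> int ^ 'n ^ 'n"
  where "mutate_mat k B = (\<chi> i j.
    if i = k \<or> j = k then - B $ i $ j
    else B $ i $ j + B $ i $ k * pos_part (B $ k $ j) + pos_part (- B $ i $ k) * B $ k $ j)"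

definition mutate_cluster ::
    "'n \<Rightarrow> 'a::field_char_0 ^ 'n \<Rightarrow> int ^ 'n ^ 'n::finite \<Rightarrow> 'a ^ 'n"
  where "mutate_cluster k x B = (\<chi> i.
    if i \<noteq> k then x $ i
    else inverse (x $ k) *
      ((\<Prod>j\<in>UNIV. x $ j ^ nat (pos_part (B $ j $ k))) +
       (\<Prod>j\<in>UNIV. x $ j ^ nat (pos_part (- B $ j $ k)))))"

definition mutate :: "'n \<Rightarrow> ('a::field_char_0, 'n::finite) seed \<Rightarrow> ('a, 'n) seed"
  where "mutate k S = (mutate_cluster k (cluster S) (exmat S), mutate_mat k (exmat S))"


section \<open>The labeled regular tree and cluster patterns\<close>

text \<open>\<open>E k u v\<close> means that u and v are joined by an edge labeled k.\<close>

definition is_path :: "('n \<Rightarrow> 'v \<Rightarrow> 'v \<Rightarrow> bool) \<Rightarrow> 'v list \<Rightarrow> 'v \<Rightarrow> 'v \<Rightarrow> bool"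
  where "is_path E p u v \<longleftrightarrow> p \<noteq> [] \<and> hd p = u \<and> last p = v \<and> distinct p \<and>
    successively (\<lambda>a b. \<exists>k. E k a b) p"

definition labeled_regular_tree :: "('n \<Rightarrow> 'v \<Rightarrow> 'v \<Rightarrow> bool) \<Rightarrow> bool"
  where "labeled_regular_tree E \<longleftrightarrow>
    (\<forall>k u v. E k u v \<longrightarrow> u \<noteq> v \<and> E k v u) \<and>
    (\<forall>k l u v. E k u v \<and> E l u v \<longrightarrow> k = l) \<and>
    (\<forall>k u. \<exists>!v. E k u v) \<and>
    (\<forall>u v. \<exists>!p. is_path E p u v)"

definition tree_path :: "('n \<Rightarrow> 'v \<Rightarrow> 'v \<Rightarrow> bool) \<Rightarrow> 'v \<Rightarrow> 'v \<Rightarrow> 'v list"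
  where "tree_path E u v = (THE p. is_path E p u v)"

definition cluster_pattern ::
    "('n \<Rightarrow> 'v \<Rightarrow> 'v \<Rightarrow> bool) \<Rightarrow> ('v \<Rightarrow> ('a::field_char_0, 'n::finite) seed) \<Rightarrow> bool"
  where "cluster_pattern E \<Sigma> \<longleftrightarrow> labeled_regular_tree E \<and> (\<forall>t. labeled_seed (\<Sigma> t)) \<and>
    (\<forall>k t t'. E k t t' \<longrightarrow> \<Sigma> t' = mutate k (\<Sigma> t))"

definition weight ::
    "('n \<Rightarrow> 'v \<Rightarrow> 'v \<Rightarrow> bool) \<Rightarrow> ('v \<Rightarrow> ('a, 'n::finite) seed) \<Rightarrow> 'v \<Rightarrow> 'v \<Rightarrow> 'v \<Rightarrow> nat"
  where "weight E \<Sigma> s t t' =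
    card {u \<in> set (tree_path E t t'). mat_sim_pm (exmat (\<Sigma> u)) (exmat (\<Sigma> s))}"


section \<open>The cluster algebra and its cluster automorphisms\<close>

definition int_subalgebra :: "'a::comm_ring_1 set \<Rightarrow> bool"
  where "int_subalgebra R \<longleftrightarrow> 0 \<in> R \<and> 1 \<in> R \<and>
    (\<forall>a\<in>R. \<forall>b\<in>R. a + b \<in> R \<and> a * b \<in> R) \<and> (\<forall>a\<in>R. - a \<in> R)"

definition cluster_algebra :: "('v \<Rightarrow> ('a::field_char_0, 'n::finite) seed) \<Rightarrow> 'a set"
  where "cluster_algebra \<Sigma> = int_subalgebra hull {cluster (\<Sigma> t) $ i | t i. True}"

text \<open>
  Maps on a subset \<open>A\<close> are represented by functions that are
  \<^const>\<open>undefined\<close> outside of \<open>A\<close> (this is part of \<^const>\<open>Bij\<close>). Compatibility with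
  the scalar multiplication by integers follows from additivity.
\<close>

definition algebra_automorphism :: "'a::comm_ring_1 set \<Rightarrow> ('a \<Rightarrow> 'a) \<Rightarrow> bool"
  where "algebra_automorphism A f \<longleftrightarrow> f \<in> Bij A \<and> f 1 = 1 \<and>
    (\<forall>a\<in>A. \<forall>b\<in>A. f (a + b) = f a + f b \<and> f (a * b) = f a * f b)"

definition map_cluster :: "('a \<Rightarrow> 'a) \<Rightarrow> 'a ^ 'n::finite \<Rightarrow> 'a ^ 'n"
  where "map_cluster f x = (\<chi> i. f (x $ i))"

definition cluster_automorphism ::
    "('v \<Rightarrow> ('a::field_char_0, 'n::finite) seed) \<Rightarrow> ('a \<Rightarrow> 'a) \<Rightarrow> bool"
  where "cluster_automorphism \<Sigma> f \<longleftrightarrow> algebra_automorphism (cluster_algebra \<Sigma>) f \<and>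
    (\<exists>S\<in>range \<Sigma>. \<exists>S'\<in>range \<Sigma>. \<exists>\<sigma>. bij \<sigma> \<and>
       perm_vec \<sigma> (map_cluster f (cluster S)) = cluster S' \<and>
       (\<forall>k. perm_vec \<sigma> (map_cluster f (cluster (mutate k S))) = cluster (mutate (\<sigma> k) S')))"

definition cluster_aut_group ::
    "('v \<Rightarrow> ('a::field_char_0, 'n::finite) seed) \<Rightarrow> ('a \<Rightarrow> 'a) monoid"
  where "cluster_aut_group \<Sigma> =
    (BijGroup (cluster_algebra \<Sigma>)) \<lparr>carrier := Collect (cluster_automorphism \<Sigma>)\<rparr>"

text \<open>
  The automorphism denoted by the quadruple \<open>(S1, S2, \<sigma>, \<epsilon>)\<close>. It is only meaningful for
  seeds of the pattern with \<open>\<sigma> B1 = \<epsilon> B2\<close>.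
\<close>

definition seed_aut ::
    "('v \<Rightarrow> ('a::field_char_0, 'n::finite) seed) \<Rightarrow>
     ('a, 'n) seed \<Rightarrow> ('a, 'n) seed \<Rightarrow> ('n \<Rightarrow> 'n) \<Rightarrow> int \<Rightarrow> 'a \<Rightarrow> 'a"
  where "seed_aut \<Sigma> S1 S2 \<sigma> \<epsilon> =
    (THE f. perm_mat \<sigma> (exmat S1) = scale_mat \<epsilon> (exmat S2) \<and>
       cluster_automorphism \<Sigma> f \<and> perm_vec \<sigma> (map_cluster f (cluster S1)) = cluster S2)"

definition G0 :: "('v \<Rightarrow> ('a::field_char_0, 'n::finite) seed) \<Rightarrow> 'v \<Rightarrow> ('a \<Rightarrow> 'a) set"
  where "G0 \<Sigma> t0 = {seed_aut \<Sigma> (\<Sigma> t0) (\<Sigma> t0) \<sigma> \<epsilon> | \<sigma> \<epsilon>.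
    bij \<sigma> \<and> \<epsilon> \<in> {1, -1} \<and> perm_mat \<sigma> (exmat (\<Sigma> t0)) = scale_mat \<epsilon> (exmat (\<Sigma> t0))}"

text \<open>Here \<open>\<sigma>\<close> and \<open>\<epsilon>\<close> are the chosen families of permutations and signs.\<close>

definition H1 ::
    "('n \<Rightarrow> 'v \<Rightarrow> 'v \<Rightarrow> bool) \<Rightarrow> ('v \<Rightarrow> ('a::field_char_0, 'n::finite) seed) \<Rightarrow>
     ('v \<Rightarrow> 'n \<Rightarrow> 'n) \<Rightarrow> ('v \<Rightarrow> int) \<Rightarrow> 'v \<Rightarrow> ('a \<Rightarrow> 'a) set"
  where "H1 E \<Sigma> \<sigma> \<epsilon> t0 = {seed_aut \<Sigma> (\<Sigma> t0) (\<Sigma> t) (\<sigma> t) (\<epsilon> t) | t.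
    mat_sim_pm (exmat (\<Sigma> t)) (exmat (\<Sigma> t0)) \<and> weight E \<Sigma> t0 t0 t = 2}"

end

theory Submission
  imports Defs
begin

text \<open>
  By algebraic independence, an exchange relation determines the corresponding column of the
  exchange matrix up to sign; indecomposability and sign-skew-symmetry make these signs agree, so a
  cluster automorphism sends some seed to a seed with the same matrix up to relabeling and a global
  sign. This property is preserved by mutation, hence a cluster automorphism acts on all seeds of
  the pattern and carries walks in the tree to walks. Given an automorphism sending the root seed
  to the seed at t, let t1 be the first vertex after the root on the path to t whose matrix is
  similar, up to sign, to that of the root. Composing with the inverse of the chosen automorphism
  for t1, which has weight 2, replaces the path to t by the shorter image of its part after t1.
  Iterating, the target becomes the root and the remaining automorphism lies in G0.
\<close>

section \<open>Evaluation of polynomials at free generating sets\<close>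

definition monom_eval :: "'a::field_char_0 ^ 'n::finite \<Rightarrow> ('n \<Rightarrow>\<^sub>0 nat) \<Rightarrow> 'a"
  where "monom_eval x m = (\<Prod>i\<in>UNIV. x $ i ^ Poly_Mapping.lookup m i)"

lemma monom_eval_add: "monom_eval x (m + m') = monom_eval x m * monom_eval x m'"
  by (simp add: monom_eval_def lookup_add power_add prod.distrib)

text \<open>Zero coefficients contribute nothing, so polynomials with different supports can be
  summed over one common index set.\<close>

lemma poly_eval_superset:
  assumes "finite M" "Poly_Mapping.keys p \<subseteq> M"
  shows "poly_eval x p = (\<Sum>m\<in>M. of_rat (Poly_Mapping.lookup p m) * monom_eval x m)"
  unfolding poly_eval_def monom_eval_def
  by (rule sum.mono_neutral_left) (use assms in \<open>auto simp: in_keys_iff\<close>)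

lemma poly_eval_0 [simp]: "poly_eval x 0 = 0"
  by (simp add: poly_eval_def)

lemma poly_eval_single: "poly_eval x (Poly_Mapping.single m c) = of_rat c * monom_eval x m"
  by (subst poly_eval_superset[where M="{m}"]) auto

lemma poly_eval_add: "poly_eval x (p + q) = poly_eval x p + poly_eval x q"
proof -
  let ?M = "Poly_Mapping.keys p \<union> Poly_Mapping.keys q"
  have "Poly_Mapping.keys (p + q) \<subseteq> ?M" by (rule keys_add)
  then show ?thesis
    by (simp add: poly_eval_superset[where M="?M"] lookup_add of_rat_add sum.distrib distrib_right)
qed

lemma poly_eval_uminus: "poly_eval x (- p) = - poly_eval x p"
  using poly_eval_add[of x p "- p"] by (simp add: eq_neg_iff_add_eq_0 add.commute)

lemma poly_eval_diff: "poly_eval x (p - q) = poly_eval x p - poly_eval x q"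
  using poly_eval_add[of x p "- q"] by (simp add: poly_eval_uminus)

text \<open>Adding one term at a time, with no condition on its exponent, reduces multiplicativity
  of evaluation to products of two monomials.\<close>

lemma poly_mapping_single_induct [case_names zero add]:
  fixes p :: "'b \<Rightarrow>\<^sub>0 'c::monoid_add"
  assumes "P 0" "\<And>p m c. P p \<Longrightarrow> P (p + Poly_Mapping.single m c)"
  shows "P p"
proof (induction p rule: update_induct)
  case (update f a b)
  have "Poly_Mapping.update a b f = f + Poly_Mapping.single a b"
    using update.hyps
    by (intro poly_mapping_eqI) (auto simp: lookup_update lookup_add lookup_single in_keys_iff when_def)
  then show ?case using assms(2)[OF update.IH] by simp
qed (simp add: assms)

lemma poly_eval_mult: "poly_eval x (p * q) = poly_eval x p * poly_eval x q"
proof (induction p rule: poly_mapping_single_induct)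
  case (add p m c)
  have "poly_eval x (Poly_Mapping.single m c * q) = poly_eval x (Poly_Mapping.single m c) * poly_eval x q"
    by (induction q rule: poly_mapping_single_induct)
      (simp_all add: distrib_left poly_eval_add mult_single poly_eval_single monom_eval_add of_rat_mult)
  then show ?case by (simp add: distrib_right poly_eval_add add.IH)
qed simp

lemma poly_eval_1 [simp]: "poly_eval x 1 = 1"
  using poly_eval_single[of x 0 1] by (simp add: monom_eval_def)

definition poly_var :: "'n::finite \<Rightarrow> ('n \<Rightarrow>\<^sub>0 nat) \<Rightarrow>\<^sub>0 rat"
  where "poly_var i = Poly_Mapping.single (Poly_Mapping.single i 1) 1"

lemma poly_eval_var [simp]: "poly_eval x (poly_var i) = x $ i"
proof -
  have "monom_eval x (Poly_Mapping.single i 1) = (\<Prod>j\<in>UNIV. if j = i then x $ j else 1)"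
    unfolding monom_eval_def by (rule prod.cong) (auto simp: lookup_single when_def)
  then show ?thesis by (simp add: poly_var_def poly_eval_single)
qed

lemma poly_eval_eq_0_iff: "free_generating_set x \<Longrightarrow> poly_eval x p = 0 \<longleftrightarrow> p = 0"
  unfolding free_generating_set_def by auto

lemma poly_eval_inject: "free_generating_set x \<Longrightarrow> poly_eval x p = poly_eval x q \<longleftrightarrow> p = q"
  using poly_eval_eq_0_iff[of x "p - q"] by (simp add: poly_eval_diff)

lemma free_generating_set_nonzero:
  assumes "free_generating_set x" shows "x $ i \<noteq> 0"
proof -
  have "poly_var i \<noteq> 0"
    unfolding poly_var_def by (metis lookup_single_eq lookup_zero zero_neq_one)
  then show ?thesis using poly_eval_eq_0_iff[OF assms, of "poly_var i"] by simp
qed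

text \<open>The fractions of polynomial values form a subfield containing the generators, so they
  exhaust the field by minimality of the hull.\<close>

lemma free_generating_set_fraction:
  fixes a :: "'a::field_char_0"
  assumes "free_generating_set x"
  obtains p q where "q \<noteq> 0" "a = poly_eval x p / poly_eval x q"
proof -
  note nz = poly_eval_eq_0_iff[OF assms]
  define K where "K = {poly_eval x p / poly_eval x q | p q. q \<noteq> 0}"
  \<comment> \<open>Absence of zero divisors among polynomials is inherited from the field through
    injectivity of evaluation.\<close>
  have pq: "q * q' \<noteq> 0" if "q \<noteq> 0" "q' \<noteq> 0" for q q' :: "('b \<Rightarrow>\<^sub>0 nat) \<Rightarrow>\<^sub>0 rat"
    using that nz by (metis poly_eval_mult mult_eq_0_iff)
  have KI: "poly_eval x p / poly_eval x q \<in> K" if "q \<noteq> 0" for p q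
    using that unfolding K_def by auto
  have one: "(1 :: ('b \<Rightarrow>\<^sub>0 nat) \<Rightarrow>\<^sub>0 rat) \<noteq> 0" by simp
  have pK: "poly_eval x p \<in> K" for p
    using KI[OF one, of p] by simp
  have "subfield_set K"
    unfolding subfield_set_def
  proof (intro conjI ballI)
    show "0 \<in> K" "1 \<in> K" using pK[of 0] pK[of 1] by simp_all
  next
    fix a b assume "a \<in> K" "b \<in> K"
    then obtain p q p' q' where *: "q \<noteq> 0" "q' \<noteq> 0" "a = poly_eval x p / poly_eval x q"
        "b = poly_eval x p' / poly_eval x q'"
      unfolding K_def by auto
    have "a + b = poly_eval x (p * q' + p' * q) / poly_eval x (q * q')"
      using * nz by (simp add: poly_eval_mult poly_eval_add add_frac_eq)
    then show "a + b \<in> K" using KI[OF pq[OF *(1,2)]] by simp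
    have "a * b = poly_eval x (p * p') / poly_eval x (q * q')"
      using * by (simp add: poly_eval_mult)
    then show "a * b \<in> K" using KI[OF pq[OF *(1,2)]] by simp
  next
    fix a assume "a \<in> K"
    then obtain p q where *: "q \<noteq> 0" "a = poly_eval x p / poly_eval x q"
      unfolding K_def by auto
    have "- a = poly_eval x (- p) / poly_eval x q" using * by (simp add: poly_eval_uminus)
    then show "- a \<in> K" using KI[OF *(1)] by simp
    show "inverse a \<in> K"
    \<comment> \<open>For \<open>p = 0\<close> the convention \<open>inverse 0 = 0\<close> applies;
      otherwise the fraction is turned over.\<close>
    proof (cases "p = 0")
      case True
      then show ?thesis using * pK[of 0] by simp
    next
      case False
      then show ?thesis using * KI[OF False, of q] by simp
    qed
  qed
  moreover have "range (($) x) \<subseteq> K"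
    using pK[of "poly_var _"] by auto
  ultimately have "subfield_set hull range (($) x) \<subseteq> K" by (simp add: hull_minimal)
  then have "a \<in> K" using assms unfolding free_generating_set_def by auto
  then show thesis using that unfolding K_def by auto
qed

section \<open>Substituting one free generating set for another\<close>

definition change_vars :: "'a::field_char_0 ^ 'n::finite \<Rightarrow> 'a ^ 'n \<Rightarrow> 'a \<Rightarrow> 'a"
  where "change_vars x y a =
    (SOME b. \<exists>p q. q \<noteq> 0 \<and> a = poly_eval x p / poly_eval x q \<and> b = poly_eval y p / poly_eval y q)"

text \<open>The choice of fraction does not matter: cross-multiplying two representations gives a
  polynomial identity because \<open>x\<close> is free. That identity also holds at
  \<open>y\<close>, where freeness keeps the denominators nonzero.\<close>

lemma change_vars_fraction:
  assumes x: "free_generating_set x" and y: "free_generating_set y" and "q \<noteq> 0"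
  shows "change_vars x y (poly_eval x p / poly_eval x q) = poly_eval y p / poly_eval y q"
  unfolding change_vars_def
proof (rule some_equality)
  show "\<exists>p' q'. q' \<noteq> 0 \<and> poly_eval x p / poly_eval x q = poly_eval x p' / poly_eval x q' \<and>
      poly_eval y p / poly_eval y q = poly_eval y p' / poly_eval y q'"
    using assms by blast
next
  fix b
  assume "\<exists>p' q'. q' \<noteq> 0 \<and> poly_eval x p / poly_eval x q = poly_eval x p' / poly_eval x q' \<and>
      b = poly_eval y p' / poly_eval y q'"
  then obtain p' q' where *: "q' \<noteq> 0" "b = poly_eval y p' / poly_eval y q'"
      "poly_eval x p / poly_eval x q = poly_eval x p' / poly_eval x q'" by blast
  then have "poly_eval x (p * q') = poly_eval x (p' * q)"
    using assms poly_eval_eq_0_iff[OF x] by (simp add: frac_eq_eq poly_eval_mult)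
  then have "p * q' = p' * q" by (simp only: poly_eval_inject[OF x])
  then have "poly_eval y p * poly_eval y q' = poly_eval y p' * poly_eval y q"
    by (metis poly_eval_mult)
  then show "b = poly_eval y p / poly_eval y q"
    using * assms poly_eval_eq_0_iff[OF y] by (simp add: frac_eq_eq)
qed

lemma change_vars_poly:
  assumes "free_generating_set x" "free_generating_set y"
  shows "change_vars x y (poly_eval x p) = poly_eval y p"
  using change_vars_fraction[OF assms, of 1 p] by simp

lemma change_vars_var:
  assumes "free_generating_set x" "free_generating_set y"
  shows "change_vars x y (x $ i) = y $ i"
  using change_vars_poly[OF assms, of "poly_var i"] by simp

lemma change_vars_inverse:
  assumes x: "free_generating_set x" and y: "free_generating_set y"
  shows "change_vars y x (change_vars x y a) = a"
proof -
  obtain p q where "q \<noteq> 0" "a = poly_eval x p / poly_eval x q"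
    using free_generating_set_fraction[OF x] .
  then show ?thesis by (simp add: change_vars_fraction x y)
qed

lemma change_vars_hom:
  assumes x: "free_generating_set x" and y: "free_generating_set y"
  shows "change_vars x y (a + b) = change_vars x y a + change_vars x y b"
    and "change_vars x y (a * b) = change_vars x y a * change_vars x y b"
proof -
  obtain p q where a: "q \<noteq> 0" "a = poly_eval x p / poly_eval x q"
    using free_generating_set_fraction[OF x] .
  obtain p' q' where b: "q' \<noteq> 0" "b = poly_eval x p' / poly_eval x q'"
    using free_generating_set_fraction[OF x] .
  have q: "q * q' \<noteq> 0"
    using a b poly_eval_eq_0_iff[OF x] by (metis poly_eval_mult mult_eq_0_iff)
  have "a + b = poly_eval x (p * q' + p' * q) / poly_eval x (q * q')"
    using a b by (simp add: poly_eval_mult poly_eval_add add_frac_eq poly_eval_eq_0_iff[OF x])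
  then show "change_vars x y (a + b) = change_vars x y a + change_vars x y b"
    using a b q by (simp add: change_vars_fraction[OF x y])
      (simp add: poly_eval_mult poly_eval_add add_frac_eq poly_eval_eq_0_iff[OF y])
  have "a * b = poly_eval x (p * p') / poly_eval x (q * q')"
    using a b by (simp add: poly_eval_mult)
  then show "change_vars x y (a * b) = change_vars x y a * change_vars x y b"
    using a b q by (simp add: change_vars_fraction[OF x y]) (simp add: poly_eval_mult)
qed

lemma change_vars_1:
  assumes "free_generating_set x" "free_generating_set y"
  shows "change_vars x y 1 = 1"
  using change_vars_poly[OF assms, of 1] by simp

text \<open>Relabeling the variables permutes the monomials, so a relation among the relabeled
  generators pulls back to a relation among the original ones.\<close>

lemma free_generating_set_reindex:
  fixes x :: "'a::field_char_0 ^ 'n::finite"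
  assumes x: "free_generating_set x" and \<sigma>: "bij \<sigma>"
  shows "free_generating_set (\<chi> j. x $ \<sigma> j)"
  unfolding free_generating_set_def
proof (intro conjI allI impI)
  have "range (($) (\<chi> j. x $ \<sigma> j)) = ($) x ` range \<sigma>"
    by (simp add: image_image)
  also have "\<dots> = range (($) x)"
    using \<sigma> by (simp add: bij_is_surj)
  finally show "subfield_set hull range (($) (\<chi> j. x $ \<sigma> j)) = UNIV"
    using x by (simp add: free_generating_set_def)
next
  fix p assume 0: "poly_eval (\<chi> j. x $ \<sigma> j) p = 0"
  \<comment> \<open>\<open>g\<close> relabels exponent vectors so that a monomial at
    \<open>x\<close> equals its relabeled version at the relabeled tuple.\<close>
  define g where "g = (\<lambda>m :: 'n \<Rightarrow>\<^sub>0 nat. Poly_Mapping.map_key \<sigma> m)"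
  have lg: "Poly_Mapping.lookup (g m) j = Poly_Mapping.lookup m (\<sigma> j)" for m j
    using \<sigma> by (simp add: g_def map_key.rep_eq bij_is_inj)
  have g_surj: "\<exists>m. g m = m'" for m'
  proof
    show "g (Poly_Mapping.map_key (inv \<sigma>) m') = m'"
      using \<sigma> by (intro poly_mapping_eqI)
        (simp add: lg map_key.rep_eq bij_is_inj bij_imp_bij_inv)
  qed
  have g_inj: "inj g"
  proof (rule injI)
    fix m m' assume "g m = g m'"
    then have "Poly_Mapping.lookup m (\<sigma> j) = Poly_Mapping.lookup m' (\<sigma> j)" for j
      by (metis lg)
    then show "m = m'" using \<sigma> by (intro poly_mapping_eqI) (metis bij_pointE)
  qed
  have bij_g: "bij g" using g_inj g_surj by (metis bijI surjI surj_def)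
  have mono: "monom_eval (\<chi> j. x $ \<sigma> j) (g m) = monom_eval x m" for m
    unfolding monom_eval_def vec_lambda_beta lg
    by (rule prod.reindex_bij_betw[of \<sigma> UNIV UNIV "\<lambda>i. x $ i ^ Poly_Mapping.lookup m i"]) (simp add: \<sigma>)
  \<comment> \<open>Precomposing the coefficients with \<open>g\<close> gives the polynomial whose
    value at \<open>x\<close> is that of \<open>p\<close> at the relabeled tuple.\<close>
  define p' where "p' = Poly_Mapping.map_key g p"
  have lp': "Poly_Mapping.lookup p' m = Poly_Mapping.lookup p (g m)" for m
    using g_inj by (simp add: p'_def map_key.rep_eq)
  have "bij_betw g (Poly_Mapping.keys p') (Poly_Mapping.keys p)"
  proof (rule bij_betw_imageI)
    show "inj_on g (Poly_Mapping.keys p')" using g_inj by (metis inj_on_subset subset_UNIV)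
    have "g m \<in> Poly_Mapping.keys p \<longleftrightarrow> m \<in> Poly_Mapping.keys p'" for m
      by (simp add: in_keys_iff lp')
    with g_surj show "g ` Poly_Mapping.keys p' = Poly_Mapping.keys p" by (metis image_eqI subsetI image_subsetI subset_antisym)
  qed
  then have "poly_eval (\<chi> j. x $ \<sigma> j) p =
      (\<Sum>m\<in>Poly_Mapping.keys p'. of_rat (Poly_Mapping.lookup p (g m)) * monom_eval (\<chi> j. x $ \<sigma> j) (g m))"
    by (simp add: poly_eval_superset[OF _ subset_refl] sum.reindex_bij_betw[symmetric])
  also have "\<dots> = poly_eval x p'"
    by (simp add: mono lp' poly_eval_superset[OF _ subset_refl])
  finally have "p' = 0" using 0 x by (simp add: poly_eval_eq_0_iff)
  then have "Poly_Mapping.lookup p (g m) = 0" for m by (metis lp' lookup_zero)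
  then show "p = 0" using g_surj by (intro poly_mapping_eqI) (metis lookup_zero)
qed

section \<open>Exchange polynomials\<close>

text \<open>The binomial of the exchange relation; \<open>b\<close> stands for a column of the
  exchange matrix.\<close>

definition exchange_poly :: "'a::field_char_0 ^ 'n::finite \<Rightarrow> ('n \<Rightarrow> int) \<Rightarrow> 'a"
  where "exchange_poly x b =
    (\<Prod>j\<in>UNIV. x $ j ^ nat (pos_part (b j))) + (\<Prod>j\<in>UNIV. x $ j ^ nat (pos_part (- b j)))"

lemma mutate_cluster_self:
  "mutate_cluster k x B $ k = inverse (x $ k) * exchange_poly x (\<lambda>j. B $ j $ k)"
  by (simp add: mutate_cluster_def exchange_poly_def)

lemma exchange_poly_uminus: "exchange_poly x (\<lambda>j. - b j) = exchange_poly x b"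
  by (simp add: exchange_poly_def add.commute)

lemma exchange_poly_reindex:
  assumes "bij \<sigma>"
  shows "exchange_poly x b = exchange_poly (\<chi> j. x $ \<sigma> j) (\<lambda>j. b (\<sigma> j))"
proof -
  have "(\<Prod>j\<in>UNIV. x $ \<sigma> j ^ nat (pos_part (c (\<sigma> j)))) = (\<Prod>j\<in>UNIV. x $ j ^ nat (pos_part (c j)))" for c
    by (rule prod.reindex_bij_betw[of \<sigma> UNIV UNIV "\<lambda>j. x $ j ^ nat (pos_part (c j))"]) (simp add: assms)
  from this[of b] this[of "\<lambda>j. - b j"] show ?thesis by (simp add: exchange_poly_def)
qed

text \<open>Comparing coefficients at the four exponents recovers the unordered pair, including the
  case of a repeated monomial with coefficient 2.\<close>

lemma single_add_single_eq:
  fixes m m' n n' :: "'b"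
  assumes "Poly_Mapping.single m (1::rat) + Poly_Mapping.single m' 1 =
    Poly_Mapping.single n 1 + Poly_Mapping.single n' 1"
  shows "m = n \<and> m' = n' \<or> m = n' \<and> m' = n"
proof -
  have "(1 when m = k) + (1 when m' = k) = (1 when n = k) + (1 when n' = k :: rat)" for k
    using arg_cong[OF assms, of "\<lambda>p. Poly_Mapping.lookup p k"] by (simp add: lookup_add lookup_single)
  from this[of m] this[of m'] this[of n] this[of n'] show ?thesis
    by (auto simp: when_def split: if_splits)
qed

text \<open>Freeness recovers the two monomials up to order, and their exponents are the positive
  and negative parts of the column. Swapping the monomials negates the column, which is the origin
  of the signs below.\<close>

lemma exchange_poly_inject:
  fixes x :: "'a::field_char_0 ^ 'n::finite"
  assumes x: "free_generating_set x" and eq: "exchange_poly x b = exchange_poly x c"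
  shows "b = c \<or> b = (\<lambda>j. - c j)"
proof -
  define e where "e = (\<lambda>b :: 'n \<Rightarrow> int. Abs_poly_mapping (\<lambda>j. nat (pos_part (b j))))"
  have e: "Poly_Mapping.lookup (e b) j = nat (pos_part (b j))" for b j
    unfolding e_def by (subst Abs_poly_mapping_inverse) auto
  have "exchange_poly x b = poly_eval x (Poly_Mapping.single (e b) 1 + Poly_Mapping.single (e (\<lambda>j. - b j)) 1)" for b
    by (simp add: exchange_poly_def poly_eval_add poly_eval_single monom_eval_def e)
  with eq have "Poly_Mapping.single (e b) (1::rat) + Poly_Mapping.single (e (\<lambda>j. - b j)) 1 =
      Poly_Mapping.single (e c) 1 + Poly_Mapping.single (e (\<lambda>j. - c j)) 1"
    by (simp add: poly_eval_inject[OF x])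
  then have "e b = e c \<and> e (\<lambda>j. - b j) = e (\<lambda>j. - c j) \<or>
      e b = e (\<lambda>j. - c j) \<and> e (\<lambda>j. - b j) = e c"
    by (rule single_add_single_eq)
  then consider "\<And>j. nat (pos_part (b j)) = nat (pos_part (c j)) \<and> nat (pos_part (- b j)) = nat (pos_part (- c j))"
    | "\<And>j. nat (pos_part (b j)) = nat (pos_part (- c j)) \<and> nat (pos_part (- b j)) = nat (pos_part (c j))"
    by (metis e)
  then show ?thesis
  proof cases
    case 1
    have "b j = c j" for j using 1[of j] by (auto simp: pos_part_def)
    then show ?thesis by auto
  next
    case 2
    have "b j = - c j" for j using 2[of j] by (auto simp: pos_part_def)
    then show ?thesis by auto
  qed
qed

section \<open>Exchange matrices and mutation\<close>

text \<open>The symmetrizer multiplies each row by a positive number, which leaves signs unchanged.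
  In this form skew-symmetrizability enters the comparison of column signs.\<close>

lemma skew_symmetrizable_sgn:
  assumes "skew_symmetrizable B"
  shows "sgn (B $ j $ i) = - sgn (B $ i $ j)"
proof -
  obtain D :: "int ^ 'a ^ 'a" where D: "\<And>i j. i \<noteq> j \<Longrightarrow> D $ i $ j = 0" "\<And>i. D $ i $ i > 0"
    and T: "transpose (D ** B) = - (D ** B)"
    using assms unfolding skew_symmetrizable_def by auto
  have DB: "(D ** B) $ i $ j = D $ i $ i * B $ i $ j" for i j
  proof -
    have "(D ** B) $ i $ j = (\<Sum>k\<in>UNIV. if k = i then D $ i $ k * B $ k $ j else 0)"
      unfolding matrix_matrix_mult_def vec_lambda_beta by (rule sum.cong) (simp_all add: D(1))
    then show ?thesis by simp
  qed
  have "D $ j $ j * B $ j $ i = - (D $ i $ i * B $ i $ j)"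
    using arg_cong[OF T, of "\<lambda>M. M $ i $ j"] by (simp add: transpose_def DB)
  then have "sgn (D $ j $ j * B $ j $ i) = sgn (- (D $ i $ i * B $ i $ j))" by simp
  then show ?thesis using D(2) by (simp add: sgn_mult sgn_minus del: mult_minus_right)
qed

text \<open>Matrix mutation commutes with negation: since the positive parts of \<open>d\<close> and
  \<open>- d\<close> differ by \<open>d\<close>, the extra products \<open>c * d\<close>
  cancel.\<close>

lemma mutate_mat_sign:
  fixes b c d :: int
  assumes "\<epsilon> \<in> {1, - 1 :: int}"
  shows "\<epsilon> * b + (\<epsilon> * c) * pos_part (\<epsilon> * d) + pos_part (- (\<epsilon> * c)) * (\<epsilon> * d) =
    \<epsilon> * (b + c * pos_part d + pos_part (- c) * d)"
proof -
  have *: "pos_part d = pos_part (- d) + d" for d by (auto simp: pos_part_def)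
  show ?thesis using assms *[of d] *[of c] by (auto simp: algebra_simps)
qed

text \<open>Indices are moved by \<open>\<sigma>\<close> on the target side, which avoids inverse
  permutations. As \<open>f\<close> is a bare function, the notion covers maps of the whole field as
  well as maps that are \<open>undefined\<close> outside the algebra.\<close>

definition seed_iso ::
    "('a \<Rightarrow> 'a) \<Rightarrow> ('n \<Rightarrow> 'n) \<Rightarrow> int \<Rightarrow> ('a::field_char_0, 'n::finite) seed \<Rightarrow> ('a, 'n) seed \<Rightarrow> bool"
  where "seed_iso f \<sigma> \<epsilon> S S' \<longleftrightarrow> bij \<sigma> \<and> \<epsilon> \<in> {1, -1} \<and>
    (\<forall>j. f (cluster S $ j) = cluster S' $ \<sigma> j) \<and>
    (\<forall>i j. exmat S' $ \<sigma> i $ \<sigma> j = \<epsilon> * exmat S $ i $ j)"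

lemma perm_vec_eq_iff:
  "bij \<sigma> \<Longrightarrow> perm_vec \<sigma> x = y \<longleftrightarrow> (\<forall>j. x $ j = y $ \<sigma> j)"
  unfolding perm_vec_def vec_eq_iff vec_lambda_beta
  by (metis bij_inv_eq_iff)

lemma perm_mat_eq_scale_iff:
  assumes "bij \<sigma>" "\<epsilon> \<in> {1, -1}"
  shows "perm_mat \<sigma> B = scale_mat \<epsilon> B' \<longleftrightarrow> (\<forall>i j. B' $ \<sigma> i $ \<sigma> j = \<epsilon> * B $ i $ j)"
proof -
  have "perm_mat \<sigma> B = scale_mat \<epsilon> B' \<longleftrightarrow> (\<forall>i j. B $ i $ j = \<epsilon> * B' $ \<sigma> i $ \<sigma> j)"
    unfolding perm_mat_def scale_mat_def vec_eq_iff vec_lambda_beta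
    by (metis assms(1) bij_inv_eq_iff)
  also have "\<dots> \<longleftrightarrow> (\<forall>i j. B' $ \<sigma> i $ \<sigma> j = \<epsilon> * B $ i $ j)"
    using assms(2) by (auto simp: eq_commute[of "- _"] neg_equal_iff_equal)
  finally show ?thesis .
qed

lemma seed_iso_iff_perm:
  "seed_iso f \<sigma> \<epsilon> S S' \<longleftrightarrow> bij \<sigma> \<and> \<epsilon> \<in> {1, -1} \<and>
    perm_vec \<sigma> (map_cluster f (cluster S)) = cluster S' \<and>
    perm_mat \<sigma> (exmat S) = scale_mat \<epsilon> (exmat S')"
  unfolding seed_iso_def
  by (metis (no_types, lifting) perm_vec_eq_iff perm_mat_eq_scale_iff map_cluster_def vec_lambda_beta)

lemma seed_iso_comp:
  assumes "seed_iso f \<sigma> \<epsilon> S S'" "seed_iso g \<tau> \<delta> S' S''"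
  shows "seed_iso (g \<circ> f) (\<tau> \<circ> \<sigma>) (\<delta> * \<epsilon>) S S''"
  using assms unfolding seed_iso_def by (auto intro: bij_comp)

lemma seed_iso_cong:
  assumes "seed_iso f \<sigma> \<epsilon> S S'" "\<And>i. f (cluster S $ i) = g (cluster S $ i)"
  shows "seed_iso g \<sigma> \<epsilon> S S'"
  using assms unfolding seed_iso_def by auto

text \<open>Undoing \<open>f\<close> on the cluster of \<open>S\<close> suffices, and the sign is
  kept because it is its own inverse.\<close>

lemma seed_iso_inverse:
  assumes "seed_iso f \<sigma> \<epsilon> S S'" "\<And>i. g (f (cluster S $ i)) = cluster S $ i"
  shows "seed_iso g (inv \<sigma>) \<epsilon> S' S"
proof -
  have \<sigma>: "bij \<sigma>" "\<sigma> (inv \<sigma> i) = i" for i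
    using assms(1) unfolding seed_iso_def by (auto simp: bij_is_surj surj_f_inv_f)
  have "g (cluster S' $ j) = cluster S $ inv \<sigma> j" for j
    using assms \<sigma> unfolding seed_iso_def by metis
  moreover have "exmat S $ inv \<sigma> i $ inv \<sigma> j = \<epsilon> * exmat S' $ i $ j" for i j
  proof -
    have "exmat S' $ i $ j = \<epsilon> * exmat S $ inv \<sigma> i $ inv \<sigma> j"
      using assms(1) \<sigma> unfolding seed_iso_def by metis
    then show ?thesis using assms(1) unfolding seed_iso_def by auto
  qed
  ultimately show ?thesis using assms(1) \<sigma> unfolding seed_iso_def by (simp add: bij_imp_bij_inv)
qed

text \<open>\<open>R\<close> will be \<open>UNIV\<close> for substitutions in the field and the
  cluster algebra for its automorphisms.\<close>

definition ring_hom_on :: "'a::comm_ring_1 set \<Rightarrow> ('a \<Rightarrow> 'a) \<Rightarrow> bool"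
  where "ring_hom_on R f \<longleftrightarrow> int_subalgebra R \<and> f 1 = 1 \<and>
    (\<forall>a\<in>R. \<forall>b\<in>R. f (a + b) = f a + f b \<and> f (a * b) = f a * f b)"

lemma ring_hom_on_power:
  assumes "ring_hom_on R f" "a \<in> R"
  shows "a ^ n \<in> R" "f (a ^ n) = f a ^ n"
proof -
  have "a ^ n \<in> R \<and> f (a ^ n) = f a ^ n"
    using assms by (induction n) (auto simp: ring_hom_on_def int_subalgebra_def)
  then show "a ^ n \<in> R" "f (a ^ n) = f a ^ n" by auto
qed

lemma ring_hom_on_prod:
  assumes "ring_hom_on R f" "\<And>i. i \<in> I \<Longrightarrow> a i \<in> R"
  shows "prod a I \<in> R" "f (prod a I) = (\<Prod>i\<in>I. f (a i))"
proof -
  have "prod a I \<in> R \<and> f (prod a I) = (\<Prod>i\<in>I. f (a i))"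
    using assms
    by (induction I rule: infinite_finite_induct) (auto simp: ring_hom_on_def int_subalgebra_def)
  then show "prod a I \<in> R" "f (prod a I) = (\<Prod>i\<in>I. f (a i))" by auto
qed

lemma ring_hom_on_exchange_poly:
  assumes f: "ring_hom_on R f" and x: "\<And>i. x $ i \<in> R"
  shows "f (exchange_poly x b) = exchange_poly (map_cluster f x) b"
proof -
  let ?m = "\<lambda>c j. x $ j ^ nat (pos_part (c j))"
  have "prod (?m c) UNIV \<in> R" "f (prod (?m c) UNIV) = (\<Prod>j\<in>UNIV. f (x $ j) ^ nat (pos_part (c j)))" for c
    using f x by (simp_all add: ring_hom_on_prod ring_hom_on_power)
  from this[of b] this[of "\<lambda>j. - b j"] show ?thesis
    using f unfolding exchange_poly_def by (auto simp: ring_hom_on_def map_cluster_def)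
qed

text \<open>Multiplying by the old variable clears the inverse from the exchange relation, so a
  homomorphism on a subalgebra can transport it.\<close>

lemma hom_mutate_cluster_self:
  assumes f: "ring_hom_on R f"
    and R: "\<And>i. cluster S $ i \<in> R" "cluster (mutate k S) $ k \<in> R"
    and nz: "cluster S $ k \<noteq> 0"
  shows "f (cluster S $ k) * f (cluster (mutate k S) $ k) =
    exchange_poly (map_cluster f (cluster S)) (\<lambda>j. exmat S $ j $ k)"
proof -
  have "cluster S $ k * cluster (mutate k S) $ k = exchange_poly (cluster S) (\<lambda>j. exmat S $ j $ k)"
    using nz by (simp add: mutate_def mutate_cluster_self)
  moreover have "f (cluster S $ k * cluster (mutate k S) $ k) =
      f (cluster S $ k) * f (cluster (mutate k S) $ k)"
    using f R unfolding ring_hom_on_def by blast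
  ultimately show ?thesis by (simp add: ring_hom_on_exchange_poly[OF f R(1)])
qed

text \<open>The sign at most swaps the two exchange monomials, so \<open>f\<close> carries one
  exchange relation to the other. Division by the nonzero old variable then determines the image of
  the new one.\<close>

lemma seed_iso_mutate:
  assumes f: "ring_hom_on R f" and iso: "seed_iso f \<sigma> \<epsilon> S S'"
    and R: "\<And>i. cluster S $ i \<in> R" "cluster (mutate k S) $ k \<in> R"
    and nz: "cluster S $ k \<noteq> 0" "cluster S' $ \<sigma> k \<noteq> 0"
  shows "seed_iso f \<sigma> \<epsilon> (mutate k S) (mutate (\<sigma> k) S')"
proof -
  have \<sigma>: "bij \<sigma>" and \<epsilon>: "\<epsilon> \<in> {1, -1}" and fx: "\<And>j. f (cluster S $ j) = cluster S' $ \<sigma> j"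
    and B: "\<And>i j. exmat S' $ \<sigma> i $ \<sigma> j = \<epsilon> * exmat S $ i $ j"
    using iso unfolding seed_iso_def by blast+
  have \<sigma>_eq: "\<sigma> i = \<sigma> j \<longleftrightarrow> i = j" for i j using \<sigma> by (metis bij_pointE)
  have "exchange_poly (cluster S') (\<lambda>j. exmat S' $ j $ \<sigma> k) =
      exchange_poly (map_cluster f (cluster S)) (\<lambda>j. exmat S' $ \<sigma> j $ \<sigma> k)"
    by (simp add: exchange_poly_reindex[OF \<sigma>, of "cluster S'"] map_cluster_def fx)
  also have "\<dots> = exchange_poly (map_cluster f (cluster S)) (\<lambda>j. exmat S $ j $ k)"
    using \<epsilon> exchange_poly_uminus by (auto simp: B)
  finally have P: "exchange_poly (cluster S') (\<lambda>j. exmat S' $ j $ \<sigma> k) =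
      cluster S' $ \<sigma> k * f (cluster (mutate k S) $ k)"
    using hom_mutate_cluster_self[OF f R nz(1)] by (simp add: fx)
  have "f (cluster (mutate k S) $ j) = cluster (mutate (\<sigma> k) S') $ \<sigma> j" for j
  proof (cases "j = k")
    case True
    then show ?thesis using nz(2) P
      by (simp add: mutate_def mutate_cluster_self)
  next
    case False
    then show ?thesis by (simp add: mutate_def mutate_cluster_def \<sigma>_eq fx)
  qed
  moreover have "exmat (mutate (\<sigma> k) S') $ \<sigma> i $ \<sigma> j = \<epsilon> * exmat (mutate k S) $ i $ j" for i j
    using mutate_mat_sign[OF \<epsilon>, of "exmat S $ i $ j" "exmat S $ i $ k" "exmat S $ k $ j"]
    by (simp add: mutate_def mutate_mat_def \<sigma>_eq B)
  ultimately show ?thesis using \<sigma> \<epsilon> unfolding seed_iso_def by blast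
qed

text \<open>Two columns joined by a nonzero entry have equal signs, because both matrices are
  sign-skew-symmetric; connectedness spreads this sign to all columns.\<close>

lemma indecomposable_sign:
  fixes B B' :: "int ^ 'n ^ 'n::finite"
  assumes ind: "indecomposable B" and sk: "skew_symmetrizable B" "skew_symmetrizable B'"
    and \<sigma>: "bij \<sigma>"
    and col: "\<And>k. (\<lambda>j. B' $ \<sigma> j $ \<sigma> k) = (\<lambda>j. B $ j $ k) \<or> (\<lambda>j. B' $ \<sigma> j $ \<sigma> k) = (\<lambda>j. - B $ j $ k)"
  obtains \<epsilon> where "\<epsilon> \<in> {1, -1}" "\<And>i j. B' $ \<sigma> i $ \<sigma> j = \<epsilon> * B $ i $ j"
proof -
  have "\<exists>e\<in>{1, -1}. \<forall>j. B' $ \<sigma> j $ \<sigma> k = e * B $ j $ k" for k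
    using col[of k] by (auto dest!: fun_cong)
  then obtain e where e: "\<And>k. e k \<in> {1, -1}" "\<And>j k. B' $ \<sigma> j $ \<sigma> k = e k * B $ j $ k"
    by metis
  have sgn: "sgn (B $ j $ i) = - sgn (B $ i $ j)" "sgn (B' $ j $ i) = - sgn (B' $ i $ j)" for i j
    using sk by (auto intro: skew_symmetrizable_sgn)
  have edge: "e i = e j" if "B $ i $ j \<noteq> 0 \<or> B $ j $ i \<noteq> 0" for i j
  proof -
    \<comment> \<open>This compares the two mutually transposed entries of \<open>B'\<close> at
      \<open>\<sigma> i\<close> and \<open>\<sigma> j\<close>, each rewritten with the sign of its
      own column.\<close>
    have "sgn (e i) * sgn (B $ j $ i) = - (sgn (e j) * sgn (B $ i $ j))"
      using sgn(2)[of "\<sigma> j" "\<sigma> i"] by (simp only: e(2) sgn_mult)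
    then have "(sgn (e i) - sgn (e j)) * sgn (B $ i $ j) = 0"
      by (simp add: sgn(1)[of j i] algebra_simps)
    moreover have "sgn (B $ i $ j) \<noteq> 0" using that sgn(1)[of j i] by (auto simp: sgn_0_0)
    ultimately show ?thesis using e(1)[of i] e(1)[of j] by auto
  qed
  have "e i = e j" for i j
  proof -
    have "(\<lambda>k l. B $ k $ l \<noteq> 0 \<or> B $ l $ k \<noteq> 0)\<^sup>*\<^sup>* i j"
      using ind unfolding indecomposable_def by blast
    then show ?thesis by (induction rule: rtranclp_induct) (simp, metis edge)
  qed
  then show thesis using that e by metis
qed

lemma mat_sim_pm_refl: "mat_sim_pm B B"
proof -
  have "B = perm_mat id B" by (simp add: perm_mat_def vec_eq_iff)
  then show ?thesis unfolding mat_sim_pm_def mat_sim_def by (metis bij_id)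
qed

lemma seed_iso_mat_sim_pm:
  assumes "seed_iso f \<sigma> \<epsilon> S S'"
  shows "mat_sim_pm (exmat S') (exmat S)"
proof -
  have \<sigma>: "bij \<sigma>" and \<epsilon>: "\<epsilon> \<in> {1, -1}" and B: "\<And>i j. exmat S' $ \<sigma> i $ \<sigma> j = \<epsilon> * exmat S $ i $ j"
    using assms unfolding seed_iso_def by blast+
  have *: "perm_mat (inv \<sigma>) (exmat S') = scale_mat \<epsilon> (exmat S)"
    using \<sigma> by (simp add: perm_mat_def scale_mat_def vec_eq_iff inv_inv_eq B)
  have "scale_mat \<epsilon> (exmat S) = exmat S \<or> scale_mat \<epsilon> (exmat S) = - exmat S"
    using \<epsilon> by (auto simp: scale_mat_def vec_eq_iff)
  then show ?thesis
    unfolding mat_sim_pm_def mat_sim_def using * \<sigma> by (metis bij_imp_bij_inv)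
qed

lemma int_subalgebra_hull: "int_subalgebra (int_subalgebra hull X)"
  by (rule hull_in) (auto simp: int_subalgebra_def)

section \<open>Cluster automorphisms as automorphisms of the seed pattern\<close>

locale indecomposable_pattern =
  fixes E :: "'n::finite \<Rightarrow> 'v \<Rightarrow> 'v \<Rightarrow> bool"
    and \<Sigma> :: "'v \<Rightarrow> ('a::field_char_0, 'n) seed"
  assumes pattern: "cluster_pattern E \<Sigma>"
    and indecomposable: "indecomposable (exmat (\<Sigma> t))"
begin

abbreviation A :: "'a set"
  where "A \<equiv> cluster_algebra \<Sigma>"

abbreviation adj :: "'v \<Rightarrow> 'v \<Rightarrow> bool"
  where "adj \<equiv> \<lambda>u v. \<exists>k. E k u v"

section \<open>Basic facts on the pattern, its tree and its algebra\<close>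

lemma tree: "labeled_regular_tree E"
  using pattern by (simp add: cluster_pattern_def)

lemma free_cluster: "free_generating_set (cluster (\<Sigma> t))"
  and skew_exmat: "skew_symmetrizable (exmat (\<Sigma> t))"
  using pattern by (auto simp: cluster_pattern_def labeled_seed_def)

lemma edge_mutate: "E k t t' \<Longrightarrow> \<Sigma> t' = mutate k (\<Sigma> t)"
  using pattern by (simp add: cluster_pattern_def)

lemma edge_ex: "\<exists>t'. E k t t'"
  using tree unfolding labeled_regular_tree_def by blast

lemma walk_ex:
  obtains p where "successively adj (u # p)" "last (u # p) = v"
proof -
  obtain q where "is_path E q u v" using tree unfolding labeled_regular_tree_def by blast
  then show thesis using that unfolding is_path_def by (cases q) auto
qed

lemma cluster_nonzero: "cluster (\<Sigma> t) $ i \<noteq> 0"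
  by (rule free_generating_set_nonzero[OF free_cluster])

lemma subalgebra: "int_subalgebra A"
  unfolding cluster_algebra_def by (rule int_subalgebra_hull)

lemma cluster_in: "cluster (\<Sigma> t) $ i \<in> A"
  unfolding cluster_algebra_def by (rule hull_inc) auto

lemma cluster_algebra_least:
  assumes "int_subalgebra K" "\<And>t i. cluster (\<Sigma> t) $ i \<in> K"
  shows "A \<subseteq> K"
  unfolding cluster_algebra_def by (rule hull_minimal) (use assms in auto)

lemma algebra_automorphism_hom: "algebra_automorphism A f \<Longrightarrow> ring_hom_on A f"
  using subalgebra by (simp add: algebra_automorphism_def ring_hom_on_def)

text \<open>The image walk is built edge by edge: label \<open>k\<close> goes to label
  \<open>\<sigma> k\<close>, and mutation preserves the isomorphism. It depends on
  \<open>\<sigma>\<close> and not on the map, so all maps in \<open>F\<close> share one image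
  walk.\<close>

lemma seed_iso_walk:
  assumes hom: "\<And>f. f \<in> F \<Longrightarrow> ring_hom_on A f"
    and "\<And>f. f \<in> F \<Longrightarrow> seed_iso f \<sigma> \<epsilon> (\<Sigma> u) (\<Sigma> u')"
    and "successively adj (u # p)"
  obtains p' where "length p' = length p" "successively adj (u' # p')"
    "\<And>f. f \<in> F \<Longrightarrow> seed_iso f \<sigma> \<epsilon> (\<Sigma> (last (u # p))) (\<Sigma> (last (u' # p')))"
proof -
  have "\<exists>p'. length p' = length p \<and> successively adj (u' # p') \<and>
      (\<forall>f\<in>F. seed_iso f \<sigma> \<epsilon> (\<Sigma> (last (u # p))) (\<Sigma> (last (u' # p'))))"
    using assms(2,3)
  proof (induction p arbitrary: u u')
    case Nil
    then show ?case by auto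
  next
    case (Cons v p)
    then obtain k where k: "E k u v" by (auto simp: successively_Cons)
    obtain v' where k': "E (\<sigma> k) u' v'" using edge_ex by blast
    have "seed_iso f \<sigma> \<epsilon> (\<Sigma> v) (\<Sigma> v')" if "f \<in> F" for f
      unfolding edge_mutate[OF k] edge_mutate[OF k']
      by (rule seed_iso_mutate[OF hom[OF that] Cons.prems(1)[OF that]])
        (simp_all add: cluster_in cluster_nonzero flip: edge_mutate[OF k])
    moreover have "successively adj (v # p)" using Cons.prems by (simp add: successively_Cons)
    ultimately obtain p' where p': "length p' = length p" "successively adj (v' # p')"
      "\<forall>f\<in>F. seed_iso f \<sigma> \<epsilon> (\<Sigma> (last (v # p))) (\<Sigma> (last (v' # p')))"
      using Cons.IH by meson
    show ?case
      by (rule exI[of _ "v' # p'"]) (use p' k' in \<open>auto simp: successively_Cons\<close>)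
  qed
  then show thesis using that by blast
qed

lemma seed_iso_everywhere:
  assumes "ring_hom_on A f" "ring_hom_on A g"
    and "seed_iso f \<sigma> \<epsilon> (\<Sigma> s) (\<Sigma> s')" "seed_iso g \<sigma> \<epsilon> (\<Sigma> s) (\<Sigma> s')"
  obtains t' where "seed_iso f \<sigma> \<epsilon> (\<Sigma> t) (\<Sigma> t')" "seed_iso g \<sigma> \<epsilon> (\<Sigma> t) (\<Sigma> t')"
proof -
  obtain p where p: "successively adj (s # p)" "last (s # p) = t" using walk_ex .
  show thesis
    by (rule seed_iso_walk[of "{f, g}", OF _ _ p(1)]) (use assms p(2) that in auto)
qed

text \<open>Both maps send each seed to the same seed with the same relabeling. They therefore agree
  on all cluster variables, hence on the algebra, and both are \<open>undefined\<close> outside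
  it.\<close>

lemma algebra_automorphism_unique:
  assumes f: "algebra_automorphism A f" and g: "algebra_automorphism A g"
    and "seed_iso f \<sigma> \<epsilon> (\<Sigma> s) (\<Sigma> s')" "seed_iso g \<sigma> \<epsilon> (\<Sigma> s) (\<Sigma> s')"
  shows "f = g"
proof -
  note hom = algebra_automorphism_hom[OF f] algebra_automorphism_hom[OF g]
  let ?K = "{a \<in> A. f a = g a}"
  have f0: "f 0 = 0" and g0: "g 0 = 0"
    using hom unfolding ring_hom_on_def int_subalgebra_def by (metis add_cancel_right_right)+
  have fm: "f (- a) = - f a" and gm: "g (- a) = - g a" if "a \<in> A" for a
    using that hom f0 g0 unfolding ring_hom_on_def int_subalgebra_def
    by (metis add_eq_0_iff2 add.right_inverse)+
  have "int_subalgebra ?K"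
    unfolding int_subalgebra_def
    using hom f0 g0 fm gm subalgebra unfolding ring_hom_on_def int_subalgebra_def by simp
  moreover have "cluster (\<Sigma> t) $ i \<in> ?K" for t i
    using seed_iso_everywhere[OF hom assms(3,4), of t] cluster_in
    by (metis (mono_tags, lifting) mem_Collect_eq seed_iso_def)
  ultimately have "A \<subseteq> ?K" by (rule cluster_algebra_least)
  then show ?thesis
    using f g unfolding algebra_automorphism_def
    by (intro extensionalityI[of f A g]) (auto simp: Bij_imp_extensional)
qed

text \<open>Every cluster variable goes to a cluster variable, so the preimage of the algebra is a
  subalgebra containing all generators.\<close>

lemma seed_iso_image_subset:
  assumes f: "ring_hom_on UNIV f" and iso: "seed_iso f \<sigma> \<epsilon> (\<Sigma> s) (\<Sigma> s')"
  shows "f ` A \<subseteq> A"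
proof -
  have hom: "ring_hom_on A f" using f subalgebra unfolding ring_hom_on_def by blast
  let ?K = "{a. f a \<in> A}"
  have add: "f (a + b) = f a + f b" "f (a * b) = f a * f b" and f1: "f 1 = 1" for a b
    using f unfolding ring_hom_on_def by auto
  have f0: "f 0 = 0" using add(1)[of 0 0] by simp
  have fm: "f (- a) = - f a" for a using add(1)[of a "- a"] f0 by (simp add: add_eq_0_iff)
  have "int_subalgebra ?K"
    using subalgebra unfolding int_subalgebra_def by (simp add: add f0 f1 fm)
  moreover have "cluster (\<Sigma> t) $ i \<in> ?K" for t i
    using seed_iso_everywhere[OF hom hom iso iso, of t] cluster_in
    by (metis (mono_tags, lifting) mem_Collect_eq seed_iso_def)
  ultimately have "A \<subseteq> ?K" by (rule cluster_algebra_least)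
  then show ?thesis by auto
qed

text \<open>The definition speaks of clusters only. Comparing exchange relations and using
  indecomposability yields the matrix condition; conversely, equivariance under mutation gives back
  the condition on the neighboring clusters.\<close>

lemma cluster_automorphism_iff:
  "cluster_automorphism \<Sigma> f \<longleftrightarrow>
    algebra_automorphism A f \<and> (\<exists>s s' \<sigma> \<epsilon>. seed_iso f \<sigma> \<epsilon> (\<Sigma> s) (\<Sigma> s'))"
proof safe
  assume f: "cluster_automorphism \<Sigma> f"
  then show "algebra_automorphism A f" by (simp add: cluster_automorphism_def)
  then have hom: "ring_hom_on A f" by (rule algebra_automorphism_hom)
  obtain s s' \<sigma> where \<sigma>: "bij \<sigma>"
    and x: "perm_vec \<sigma> (map_cluster f (cluster (\<Sigma> s))) = cluster (\<Sigma> s')"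
    and m: "\<And>k. perm_vec \<sigma> (map_cluster f (cluster (mutate k (\<Sigma> s)))) = cluster (mutate (\<sigma> k) (\<Sigma> s'))"
    using f unfolding cluster_automorphism_def by blast
  have fx: "f (cluster (\<Sigma> s) $ j) = cluster (\<Sigma> s') $ \<sigma> j" for j
    using x by (simp add: perm_vec_eq_iff[OF \<sigma>] map_cluster_def)
  have fm: "f (cluster (mutate k (\<Sigma> s)) $ k) = cluster (mutate (\<sigma> k) (\<Sigma> s')) $ \<sigma> k" for k
    using m[of k] by (simp add: perm_vec_eq_iff[OF \<sigma>] map_cluster_def)
  \<comment> \<open>The target cluster is relabeled by the source indices, so both exchange
    polynomials are evaluated at one free generating set.\<close>
  let ?y = "\<chi> j. cluster (\<Sigma> s') $ \<sigma> j"
  have y: "free_generating_set ?y"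
    by (rule free_generating_set_reindex[OF free_cluster \<sigma>])
  have col: "(\<lambda>j. exmat (\<Sigma> s') $ \<sigma> j $ \<sigma> k) = (\<lambda>j. exmat (\<Sigma> s) $ j $ k) \<or>
      (\<lambda>j. exmat (\<Sigma> s') $ \<sigma> j $ \<sigma> k) = (\<lambda>j. - exmat (\<Sigma> s) $ j $ k)" for k
  proof -
    obtain t where t: "E k s t" using edge_ex by blast
    have "exchange_poly ?y (\<lambda>j. exmat (\<Sigma> s) $ j $ k) =
        f (cluster (\<Sigma> s) $ k) * f (cluster (mutate k (\<Sigma> s)) $ k)"
      by (subst hom_mutate_cluster_self[OF hom])
        (simp_all add: cluster_in cluster_nonzero fx map_cluster_def flip: edge_mutate[OF t])
    also have "\<dots> = exchange_poly (cluster (\<Sigma> s')) (\<lambda>j. exmat (\<Sigma> s') $ j $ \<sigma> k)"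
      unfolding fx fm by (simp add: mutate_def mutate_cluster_self cluster_nonzero)
    also have "\<dots> = exchange_poly ?y (\<lambda>j. exmat (\<Sigma> s') $ \<sigma> j $ \<sigma> k)"
      by (rule exchange_poly_reindex[OF \<sigma>])
    finally show ?thesis using exchange_poly_inject[OF y] by metis
  qed
  obtain \<epsilon> where "\<epsilon> \<in> {1, -1}"
    "\<And>i j. exmat (\<Sigma> s') $ \<sigma> i $ \<sigma> j = \<epsilon> * exmat (\<Sigma> s) $ i $ j"
    using indecomposable_sign[OF indecomposable skew_exmat skew_exmat \<sigma> col] by metis
  then have "seed_iso f \<sigma> \<epsilon> (\<Sigma> s) (\<Sigma> s')"
    using \<sigma> fx unfolding seed_iso_def by blast
  then show "\<exists>s s' \<sigma> \<epsilon>. seed_iso f \<sigma> \<epsilon> (\<Sigma> s) (\<Sigma> s')" by blast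
next
  fix s s' \<sigma> \<epsilon>
  assume f: "algebra_automorphism A f" and iso: "seed_iso f \<sigma> \<epsilon> (\<Sigma> s) (\<Sigma> s')"
  have "seed_iso f \<sigma> \<epsilon> (mutate k (\<Sigma> s)) (mutate (\<sigma> k) (\<Sigma> s'))" for k
  proof -
    obtain t where t: "E k s t" using edge_ex by blast
    show ?thesis
      by (rule seed_iso_mutate[OF algebra_automorphism_hom[OF f] iso])
        (simp_all add: cluster_in cluster_nonzero flip: edge_mutate[OF t])
  qed
  then show "cluster_automorphism \<Sigma> f"
    using f iso unfolding cluster_automorphism_def seed_iso_iff_perm by blast
qed

section \<open>The automorphism attached to a quadruple\<close>

lemma cluster_automorphism_algebra: "cluster_automorphism \<Sigma> f \<Longrightarrow> algebra_automorphism A f"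
  by (simp add: cluster_automorphism_def)

lemma cluster_automorphism_Bij: "cluster_automorphism \<Sigma> f \<Longrightarrow> f \<in> Bij A"
  by (simp add: cluster_automorphism_def algebra_automorphism_def)

lemma cluster_automorphism_seed_iso:
  assumes "cluster_automorphism \<Sigma> f"
  obtains t' \<sigma> \<epsilon> where "seed_iso f \<sigma> \<epsilon> (\<Sigma> t) (\<Sigma> t')"
  using assms seed_iso_everywhere algebra_automorphism_hom unfolding cluster_automorphism_iff by metis

text \<open>The substitution of the relabeled target cluster for the source cluster is a field
  automorphism. It and its inverse map the algebra into itself, so it restricts to an automorphism
  of the algebra.\<close>

lemma seed_aut_ex:
  assumes \<sigma>: "bij \<sigma>" and \<epsilon>: "\<epsilon> \<in> {1, -1}"
    and B: "perm_mat \<sigma> (exmat (\<Sigma> s)) = scale_mat \<epsilon> (exmat (\<Sigma> t))"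
  obtains f where "cluster_automorphism \<Sigma> f" "seed_iso f \<sigma> \<epsilon> (\<Sigma> s) (\<Sigma> t)"
proof -
  let ?x = "cluster (\<Sigma> s)" and ?y = "\<chi> j. cluster (\<Sigma> t) $ \<sigma> j"
  have x: "free_generating_set ?x" and y: "free_generating_set ?y"
    by (simp_all add: free_cluster free_generating_set_reindex \<sigma>)
  let ?F = "change_vars ?x ?y" and ?G = "change_vars ?y ?x"
  have hom: "ring_hom_on UNIV ?F" "ring_hom_on UNIV ?G"
    unfolding ring_hom_on_def int_subalgebra_def
    by (simp_all add: change_vars_hom change_vars_1 x y)
  have F: "seed_iso ?F \<sigma> \<epsilon> (\<Sigma> s) (\<Sigma> t)"
    using \<sigma> \<epsilon> B change_vars_var[OF x y] unfolding seed_iso_def perm_mat_eq_scale_iff[OF \<sigma> \<epsilon>] by simp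
  have G: "seed_iso ?G (inv \<sigma>) \<epsilon> (\<Sigma> t) (\<Sigma> s)"
    by (rule seed_iso_inverse[OF F]) (simp add: change_vars_inverse x y)
  have "bij_betw ?F A A"
    by (rule bij_betw_byWitness[where f' = ?G])
      (use seed_iso_image_subset[OF hom(1) F] seed_iso_image_subset[OF hom(2) G]
        in \<open>simp_all add: change_vars_inverse x y\<close>)
  then have "algebra_automorphism A (restrict ?F A)"
    using hom(1) subalgebra unfolding algebra_automorphism_def Bij_def ring_hom_on_def int_subalgebra_def
    by (simp add: bij_betw_restrict_eq)
  moreover have "seed_iso (restrict ?F A) \<sigma> \<epsilon> (\<Sigma> s) (\<Sigma> t)"
    by (rule seed_iso_cong[OF F]) (simp add: cluster_in)
  ultimately show thesis using that cluster_automorphism_iff by blast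
qed

text \<open>Uniqueness of the automorphism with given action on one seed resolves the definite
  description.\<close>

lemma seed_aut_eqI:
  assumes f: "cluster_automorphism \<Sigma> f" and iso: "seed_iso f \<sigma> \<epsilon> (\<Sigma> s) (\<Sigma> t)"
  shows "seed_aut \<Sigma> (\<Sigma> s) (\<Sigma> t) \<sigma> \<epsilon> = f"
  unfolding seed_aut_def
proof (rule the_equality)
  show "perm_mat \<sigma> (exmat (\<Sigma> s)) = scale_mat \<epsilon> (exmat (\<Sigma> t)) \<and> cluster_automorphism \<Sigma> f \<and>
      perm_vec \<sigma> (map_cluster f (cluster (\<Sigma> s))) = cluster (\<Sigma> t)"
    using f iso by (simp add: seed_iso_iff_perm)
next
  fix g
  assume g: "perm_mat \<sigma> (exmat (\<Sigma> s)) = scale_mat \<epsilon> (exmat (\<Sigma> t)) \<and> cluster_automorphism \<Sigma> g \<and>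
      perm_vec \<sigma> (map_cluster g (cluster (\<Sigma> s))) = cluster (\<Sigma> t)"
  then have "seed_iso g \<sigma> \<epsilon> (\<Sigma> s) (\<Sigma> t)" using iso by (simp add: seed_iso_iff_perm)
  then show "g = f"
    using algebra_automorphism_unique g f iso by (meson cluster_automorphism_algebra)
qed

lemma seed_aut:
  assumes "bij \<sigma>" "\<epsilon> \<in> {1, -1}" "perm_mat \<sigma> (exmat (\<Sigma> s)) = scale_mat \<epsilon> (exmat (\<Sigma> t))"
  shows "cluster_automorphism \<Sigma> (seed_aut \<Sigma> (\<Sigma> s) (\<Sigma> t) \<sigma> \<epsilon>)"
    and "seed_iso (seed_aut \<Sigma> (\<Sigma> s) (\<Sigma> t) \<sigma> \<epsilon>) \<sigma> \<epsilon> (\<Sigma> s) (\<Sigma> t)"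
  using seed_aut_ex[OF assms] seed_aut_eqI by metis+

section \<open>The cluster automorphism group\<close>

abbreviation Aut :: "('a \<Rightarrow> 'a) monoid"
  where "Aut \<equiv> cluster_aut_group \<Sigma>"

text \<open>Each automorphism acts on every seed, so \<open>f\<close> can be examined at the very
  seed where \<open>g\<close> lands.\<close>

lemma cluster_automorphism_compose:
  assumes f: "cluster_automorphism \<Sigma> f" and g: "cluster_automorphism \<Sigma> g"
  shows "cluster_automorphism \<Sigma> (compose A f g)"
proof -
  fix t
  obtain t' \<sigma> \<epsilon> where g': "seed_iso g \<sigma> \<epsilon> (\<Sigma> t) (\<Sigma> t')"
    using cluster_automorphism_seed_iso[OF g] .
  obtain t'' \<tau> \<delta> where f': "seed_iso f \<tau> \<delta> (\<Sigma> t') (\<Sigma> t'')"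
    using cluster_automorphism_seed_iso[OF f] .
  have "seed_iso (compose A f g) (\<tau> \<circ> \<sigma>) (\<delta> * \<epsilon>) (\<Sigma> t) (\<Sigma> t'')"
    by (rule seed_iso_cong[OF seed_iso_comp[OF g' f']]) (simp add: cluster_in compose_def)
  moreover have "algebra_automorphism A (compose A f g)"
  proof -
    have "g a \<in> A" if "a \<in> A" for a
      using g that cluster_automorphism_Bij Bij_imp_funcset by blast
    then show ?thesis
      using f g subalgebra compose_Bij
      unfolding cluster_automorphism_def algebra_automorphism_def int_subalgebra_def
      by (auto simp: compose_eq)
  qed
  ultimately show ?thesis using cluster_automorphism_iff by blast
qed

lemma cluster_automorphism_inverse:
  assumes f: "cluster_automorphism \<Sigma> f"
  shows "cluster_automorphism \<Sigma> (restrict (inv_into A f) A)"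
proof -
  fix t
  let ?g = "restrict (inv_into A f) A"
  have B: "f \<in> Bij A" using f by (rule cluster_automorphism_Bij)
  then have inj: "inj_on f A" and f_in: "\<And>a. a \<in> A \<Longrightarrow> f a \<in> A"
    by (auto simp: Bij_def bij_betw_def)
  have g_in: "inv_into A f a \<in> A" if "a \<in> A" for a using B that by (rule Bij_inv_into_mem)
  have gf: "?g (f a) = a" if "a \<in> A" for a
    using that inj f_in by simp
  have fg: "f (inv_into A f a) = a" if "a \<in> A" for a
    using that B by (metis (no_types, lifting) Bij_def Int_iff bij_betw_def f_inv_into_f mem_Collect_eq)
  obtain t' \<sigma> \<epsilon> where "seed_iso f \<sigma> \<epsilon> (\<Sigma> t) (\<Sigma> t')"
    using cluster_automorphism_seed_iso[OF f] .
  then have "seed_iso ?g (inv \<sigma>) \<epsilon> (\<Sigma> t') (\<Sigma> t)"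
    by (rule seed_iso_inverse) (rule gf[OF cluster_in])
  moreover have "algebra_automorphism A ?g"
    unfolding algebra_automorphism_def
  proof (intro conjI ballI)
    have hom: "ring_hom_on A f"
      by (rule algebra_automorphism_hom[OF cluster_automorphism_algebra[OF f]])
    show "?g \<in> Bij A" using B by (rule restrict_inv_into_Bij)
    have "1 \<in> A" "f 1 = 1" using hom by (auto simp: ring_hom_on_def int_subalgebra_def)
    then show "?g 1 = 1" using gf by metis
    fix a b assume ab: "a \<in> A" "b \<in> A"
    let ?a = "inv_into A f a" and ?b = "inv_into A f b"
    have "f (?a + ?b) = a + b" "f (?a * ?b) = a * b" "?a + ?b \<in> A" "?a * ?b \<in> A"
      using hom g_in ab fg by (auto simp: ring_hom_on_def int_subalgebra_def)
    then show "?g (a + b) = ?g a + ?g b" "?g (a * b) = ?g a * ?g b"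
      using gf ab by (metis restrict_apply')+
  qed
  ultimately show ?thesis using cluster_automorphism_iff by blast
qed

lemma subgroup_cluster_automorphisms: "subgroup (Collect (cluster_automorphism \<Sigma>)) (BijGroup A)"
proof (rule group.subgroupI[OF group_BijGroup])
  show "Collect (cluster_automorphism \<Sigma>) \<subseteq> carrier (BijGroup A)"
    by (auto simp: BijGroup_def cluster_automorphism_Bij)
next
  fix t
  show "Collect (cluster_automorphism \<Sigma>) \<noteq> {}"
    using seed_aut_ex[of id 1 t t] by (auto simp: perm_mat_def scale_mat_def)
next
  fix f assume "f \<in> Collect (cluster_automorphism \<Sigma>)"
  then show "m_inv (BijGroup A) f \<in> Collect (cluster_automorphism \<Sigma>)"
    by (simp add: inv_BijGroup cluster_automorphism_Bij cluster_automorphism_inverse)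
next
  fix f g assume "f \<in> Collect (cluster_automorphism \<Sigma>)" "g \<in> Collect (cluster_automorphism \<Sigma>)"
  then show "f \<otimes>\<^bsub>BijGroup A\<^esub> g \<in> Collect (cluster_automorphism \<Sigma>)"
    by (simp add: BijGroup_def cluster_automorphism_Bij cluster_automorphism_compose)
qed

lemma carrier_Aut: "carrier Aut = Collect (cluster_automorphism \<Sigma>)"
  and mult_Aut: "\<lbrakk>cluster_automorphism \<Sigma> f; cluster_automorphism \<Sigma> g\<rbrakk> \<Longrightarrow> f \<otimes>\<^bsub>Aut\<^esub> g = compose A f g"
  and one_Aut: "\<one>\<^bsub>Aut\<^esub> = (\<lambda>a\<in>A. a)"
  by (simp_all add: cluster_aut_group_def BijGroup_def cluster_automorphism_Bij)

lemma group_Aut: "group Aut"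
  unfolding cluster_aut_group_def
  by (rule group.subgroup_imp_group[OF group_BijGroup subgroup_cluster_automorphisms])

text \<open>A walk without repeated vertices is the unique tree path, and here only its two ends are
  counted.\<close>

lemma weight_first_return:
  assumes walk: "successively adj (u # p @ [t])" "distinct (u # p @ [t])"
    and t: "mat_sim_pm (exmat (\<Sigma> t)) (exmat (\<Sigma> u))"
    and p: "\<forall>v\<in>set p. \<not> mat_sim_pm (exmat (\<Sigma> v)) (exmat (\<Sigma> u))"
  shows "weight E \<Sigma> u u t = 2"
proof -
  have path: "is_path E (u # p @ [t]) u t" using walk by (simp add: is_path_def)
  have "\<exists>!q. is_path E q u t" using tree unfolding labeled_regular_tree_def by blast
  then have "tree_path E u t = u # p @ [t]"
    unfolding tree_path_def by (rule the1_equality) (rule path)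
  then have "{v \<in> set (tree_path E u t). mat_sim_pm (exmat (\<Sigma> v)) (exmat (\<Sigma> u))} = {u, t}"
    using t p mat_sim_pm_refl by auto
  then show ?thesis using walk(2) by (simp add: weight_def)
qed

text \<open>Induction on the length of a walk, not of a tree path: the image of a walk under a cluster
  automorphism is a walk by construction, and a shortest walk is automatically a path.\<close>

lemma seed_iso_in_generate:
  fixes \<sigma> :: "'v \<Rightarrow> 'n \<Rightarrow> 'n" and \<epsilon> :: "'v \<Rightarrow> int"
  assumes choice: "\<And>t. mat_sim_pm (exmat (\<Sigma> t)) (exmat (\<Sigma> t0)) \<Longrightarrow>
      bij (\<sigma> t) \<and> \<epsilon> t \<in> {1, -1} \<and>
      perm_mat (\<sigma> t) (exmat (\<Sigma> t0)) = scale_mat (\<epsilon> t) (exmat (\<Sigma> t))"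
    and "successively adj (t0 # p)" "cluster_automorphism \<Sigma> f"
    and "seed_iso f \<rho> \<delta> (\<Sigma> t0) (\<Sigma> (last (t0 # p)))"
  shows "f \<in> generate Aut (G0 \<Sigma> t0 \<union> H1 E \<Sigma> \<sigma> \<epsilon> t0)"
  using assms(2-)
proof (induction "length p" arbitrary: p f \<rho> \<delta> rule: less_induct)
  case less
  interpret group Aut by (rule group_Aut)
  let ?X = "G0 \<Sigma> t0 \<union> H1 E \<Sigma> \<sigma> \<epsilon> t0"
  note walk = less.prems(1) and f = less.prems(2) and iso = less.prems(3)
  consider "p = []" | "\<not> distinct (t0 # p)" | "p \<noteq> []" "distinct (t0 # p)" by blast
  then show ?case
  proof cases
    case 1
    \<comment> \<open>The root seed goes to itself, so \<open>f\<close> is one of the generators in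
      \<open>G0\<close>.\<close>
    then have iso': "seed_iso f \<rho> \<delta> (\<Sigma> t0) (\<Sigma> t0)" using iso by simp
    then have "f \<in> G0 \<Sigma> t0"
      unfolding G0_def using seed_aut_eqI[OF f iso', symmetric] seed_iso_iff_perm by blast
    then show ?thesis by (simp add: generate.incl)
  next
    case 2
    then obtain xs y ys zs where eq: "t0 # p = xs @ [y] @ ys @ [y] @ zs"
      by (metis not_distinct_decomp)
    \<comment> \<open>A repeated vertex \<open>y\<close> bounds a closed detour; cutting it out
      shortens the walk without moving its ends.\<close>
    obtain p' where p': "xs @ [y] @ zs = t0 # p'"
      using eq by (cases xs) auto
    have "length p' < length p"
      using arg_cong[OF eq, of length] arg_cong[OF p', of length] by simp
    moreover have "successively adj (t0 # p')"
      using walk unfolding eq p'[symmetric] by (auto simp: successively_append_iff successively_Cons)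
    moreover have "last (t0 # p') = last (t0 # p)"
      unfolding eq p'[symmetric] by simp
    ultimately show ?thesis using less.hyps f iso by metis
  next
    case 3
    let ?sim = "\<lambda>t. mat_sim_pm (exmat (\<Sigma> t)) (exmat (\<Sigma> t0))"
    \<comment> \<open>The seed isomorphism makes the last matrix similar to the root's up to sign,
      so a first return after the root exists.\<close>
    have "?sim (last p)" using seed_iso_mat_sim_pm[OF iso] 3(1) by simp
    then have "\<exists>t\<in>set p. ?sim t" using 3(1) last_in_set by blast
    then obtain ys t1 zs where p: "p = ys @ t1 # zs" and t1: "?sim t1" and ys: "\<forall>t\<in>set ys. \<not> ?sim t"
      by (rule split_list_first_propE)
    define g where "g = seed_aut \<Sigma> (\<Sigma> t0) (\<Sigma> t1) (\<sigma> t1) (\<epsilon> t1)"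
    have g: "cluster_automorphism \<Sigma> g" "seed_iso g (\<sigma> t1) (\<epsilon> t1) (\<Sigma> t0) (\<Sigma> t1)"
      unfolding g_def using choice[OF t1] by (auto intro!: seed_aut)
    have "successively adj ((t0 # ys @ [t1]) @ zs)" using walk p by simp
    then have "successively adj (t0 # ys @ [t1])" unfolding successively_append_iff by blast
    then have "weight E \<Sigma> t0 t0 t1 = 2"
      by (rule weight_first_return) (use 3(2) p t1 ys in auto)
    then have gX: "g \<in> ?X" using t1 unfolding H1_def g_def by blast
    \<comment> \<open>The inverse of \<open>g\<close> brings \<open>t1\<close> back to the root, so
      \<open>h\<close> after \<open>f\<close> is to be reached by a shorter walk.\<close>
    define h where "h = m_inv Aut g"
    have gc: "g \<in> carrier Aut" and fc: "f \<in> carrier Aut" using g f by (simp_all add: carrier_Aut)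
    then have h: "cluster_automorphism \<Sigma> h" unfolding h_def using inv_closed carrier_Aut by blast
    have "h \<otimes>\<^bsub>Aut\<^esub> g = \<one>\<^bsub>Aut\<^esub>" unfolding h_def using gc by (rule l_inv)
    then have "compose A h g = (\<lambda>a\<in>A. a)" by (simp only: mult_Aut[OF h g(1)] one_Aut)
    then have "h (g a) = a" if "a \<in> A" for a
      using that by (metis compose_eq restrict_apply')
    then have h_iso: "seed_iso h (inv (\<sigma> t1)) (\<epsilon> t1) (\<Sigma> t1) (\<Sigma> t0)"
      using cluster_in by (intro seed_iso_inverse[OF g(2)]) blast
    have walk1: "successively adj (t1 # zs)"
      using walk unfolding p append_Cons[symmetric] successively_append_iff by blast
    have hom: "ring_hom_on A h"
      using h by (intro algebra_automorphism_hom cluster_automorphism_algebra)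
    \<comment> \<open>\<open>h\<close> carries the remaining walk from \<open>t1\<close> to a walk
      of the same length from the root. It is shorter than \<open>p\<close>, which also contains
      \<open>t1\<close>.\<close>
    obtain p' where p': "length p' = length zs" "successively adj (t0 # p')"
      "seed_iso h (inv (\<sigma> t1)) (\<epsilon> t1) (\<Sigma> (last (t1 # zs))) (\<Sigma> (last (t0 # p')))"
      by (rule seed_iso_walk[of "{h}", OF _ _ walk1]) (use hom h_iso in auto)
    have iso1: "seed_iso f \<rho> \<delta> (\<Sigma> t0) (\<Sigma> (last (t1 # zs)))" using iso by (simp add: p)
    have "seed_iso (compose A h f) (inv (\<sigma> t1) \<circ> \<rho>) (\<epsilon> t1 * \<delta>) (\<Sigma> t0) (\<Sigma> (last (t0 # p')))"
      by (rule seed_iso_cong[OF seed_iso_comp[OF iso1 p'(3)]]) (simp add: cluster_in compose_eq)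
    then have "compose A h f \<in> generate Aut ?X"
      by (intro less.hyps[OF _ p'(2)] cluster_automorphism_compose h f) (simp add: p p'(1))
    then have "g \<otimes>\<^bsub>Aut\<^esub> (h \<otimes>\<^bsub>Aut\<^esub> f) \<in> generate Aut ?X"
      unfolding mult_Aut[OF h f] using generate.incl[OF gX] by (rule generate.eng[rotated])
    \<comment> \<open>Multiplying by the generator \<open>g\<close> cancels \<open>h\<close> and
      recovers \<open>f\<close>.\<close>
    moreover have "g \<otimes>\<^bsub>Aut\<^esub> (h \<otimes>\<^bsub>Aut\<^esub> f) = f"
      unfolding h_def using gc fc by (simp flip: m_assoc)
    ultimately show ?thesis by simp
  qed
qed

end

theorem theorem3p11:
  fixes E :: "'n::finite \<Rightarrow> 'v \<Rightarrow> 'v \<Rightarrow> bool"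
    and \<Sigma> :: "'v \<Rightarrow> ('a::field_char_0, 'n) seed"
    and t0 :: 'v
    and \<sigma> :: "'v \<Rightarrow> 'n \<Rightarrow> 'n"
    and \<epsilon> :: "'v \<Rightarrow> int"
  assumes "cluster_pattern E \<Sigma>"
    and "\<And>t. indecomposable (exmat (\<Sigma> t))"
    and "\<And>t. mat_sim_pm (exmat (\<Sigma> t)) (exmat (\<Sigma> t0)) \<Longrightarrow>
           bij (\<sigma> t) \<and> \<epsilon> t \<in> {1, -1} \<and>
           perm_mat (\<sigma> t) (exmat (\<Sigma> t0)) = scale_mat (\<epsilon> t) (exmat (\<Sigma> t))"
  shows "generate (cluster_aut_group \<Sigma>) (G0 \<Sigma> t0 \<union> H1 E \<Sigma> \<sigma> \<epsilon> t0) =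
         carrier (cluster_aut_group \<Sigma>)"
proof -
  interpret indecomposable_pattern E \<Sigma> using assms(1,2) by unfold_locales
  show ?thesis
  proof
    have "G0 \<Sigma> t0 \<union> H1 E \<Sigma> \<sigma> \<epsilon> t0 \<subseteq> carrier Aut"
      unfolding G0_def H1_def carrier_Aut using assms(3) seed_aut(1) by blast
    then show "generate Aut (G0 \<Sigma> t0 \<union> H1 E \<Sigma> \<sigma> \<epsilon> t0) \<subseteq> carrier Aut"
      by (rule group.generate_incl[OF group_Aut])
  next
    show "carrier Aut \<subseteq> generate Aut (G0 \<Sigma> t0 \<union> H1 E \<Sigma> \<sigma> \<epsilon> t0)"
    proof
      fix f assume "f \<in> carrier Aut"
      then have f: "cluster_automorphism \<Sigma> f" by (simp add: carrier_Aut)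
      obtain t \<rho> \<delta> where iso: "seed_iso f \<rho> \<delta> (\<Sigma> t0) (\<Sigma> t)"
        using cluster_automorphism_seed_iso[OF f] .
      \<comment> \<open>The vertex receiving the root seed is joined to the root by a walk, which
        starts the induction.\<close>
      obtain p where p: "successively adj (t0 # p)" and t: "last (t0 # p) = t" using walk_ex .
      show "f \<in> generate Aut (G0 \<Sigma> t0 \<union> H1 E \<Sigma> \<sigma> \<epsilon> t0)"
        using assms(3) p f iso[folded t] by (rule seed_iso_in_generate)
    qed
  qed
qed

end
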